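(* For every integer $n\ge 4$, let $S_n=K_{1,n-1}$ be the star on $n$ vertices and let $S_n^+$ be the graph obtained from $S_n$ by adding an edge between two leaves. Then $$\dot E_{ISI}(S_n^+)>\dot E_{ISI}(S_n).$$ Equivalently, deleting the added leaf–leaf edge from $S_n^+$ strictly decreases the $ISI$ energy.
   Context: For a finite simple graph $G$ with vertices $v_1,\dots,v_n$ of degrees $d_1,\dots,d_n$, the inverse sum indeg matrix $ISI(G)$ is the $n\times n$ real symmetric matrix whose $(i,j)$ entry is $\frac{d_id_j}{d_i+d_j}$ if $v_i$ and $v_j$ are adjacent, and $0$ otherwise. The $ISI$ energy $\dot E_{ISI}(G)$ is the sum of the absolute values of the eigenvalues of $ISI(G)$. Each matrix is computed with the degrees of the graph in question. *)

theory Defs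
  imports "Graph_Theory.Kuratowski" "Jordan_Normal_Form.Char_Poly"
begin

text \<open>
  Simple graphs are the symmetric loop-free digraphs of \<^theory>\<open>Graph_Theory.Pair_Digraph\<close>: an edge
  \<open>{u, v}\<close> is the pair of arcs \<open>(u, v)\<close>, \<open>(v, u)\<close>. Hence the degree of \<open>v\<close> is its out-degree (which
  equals its in-degree); the total degree of the digraph would count every edge twice.
\<close>

definition gdegree :: "'a pair_pre_digraph \<Rightarrow> 'a \<Rightarrow> nat" where
  "gdegree G v = out_degree (with_proj G) v"

definition is_leaf :: "'a pair_pre_digraph \<Rightarrow> 'a \<Rightarrow> bool" where
  "is_leaf G v \<longleftrightarrow> v \<in> pverts G \<and> gdegree G v = 1"

definition add_edge :: "'a \<Rightarrow> 'a \<Rightarrow> 'a pair_pre_digraph \<Rightarrow> 'a pair_pre_digraph" where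
  "add_edge u v G = \<lparr>pverts = pverts G, parcs = parcs G \<union> {(u, v), (v, u)}\<rparr>"

definition del_edge :: "'a \<Rightarrow> 'a \<Rightarrow> 'a pair_pre_digraph \<Rightarrow> 'a pair_pre_digraph" where
  "del_edge u v G = \<lparr>pverts = pverts G, parcs = parcs G - {(u, v), (v, u)}\<rparr>"

definition enumerates :: "'a list \<Rightarrow> 'a set \<Rightarrow> bool" where
  "enumerates vs V \<longleftrightarrow> distinct vs \<and> set vs = V"

definition isi_matrix :: "'a pair_pre_digraph \<Rightarrow> 'a list \<Rightarrow> real mat" where
  "isi_matrix G vs = mat (length vs) (length vs) (\<lambda>(i, j).
     if (vs ! i, vs ! j) \<in> parcs G
     then real (gdegree G (vs ! i)) * real (gdegree G (vs ! j)) /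
          (real (gdegree G (vs ! i)) + real (gdegree G (vs ! j)))
     else 0)"

text \<open>
  Each eigenvalue is counted with its algebraic multiplicity. The definition is meant for real
  symmetric matrices, all of whose complex eigenvalues are real.
\<close>

definition eigenvalue_abs_sum :: "real mat \<Rightarrow> real" where
  "eigenvalue_abs_sum A =
     (\<Sum>k | eigenvalue A k. real (Polynomial.order k (char_poly A)) * \<bar>k\<bar>)"

text \<open>
  The enumeration of the vertices is irrelevant for finite graphs: see
  \<open>isi_energy_enumeration\<close> below.
\<close>

definition isi_energy :: "'a pair_pre_digraph \<Rightarrow> real" where
  "isi_energy G = eigenvalue_abs_sum (isi_matrix G (SOME vs. enumerates vs (pverts G)))"

lemma sum_nth_delta:
  assumes "distinct xs" "x \<in> set xs" "length xs = n"
  shows "(\<Sum>k<n. if x = xs ! k then f (xs ! k) else (0 :: real)) = f x"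
proof -
  have "(\<Sum>k<n. if x = xs ! k then f (xs ! k) else (0 :: real)) =
      sum_list (map (\<lambda>y. if x = y then f y else 0) xs)"
    using assms(3) by (simp add: sum_list_sum_nth atLeast0LessThan)
  also have "\<dots> = (\<Sum>y\<in>set xs. if x = y then f y else 0)"
    using assms(1) by (rule sum_list_distinct_conv_sum_set)
  also have "\<dots> = f x" using assms(2) by simp
  finally show ?thesis .
qed

lemma isi_matrix_similar:
  assumes vs: "enumerates vs V" and ws: "enumerates ws V"
  shows "similar_mat (isi_matrix G vs) (isi_matrix G ws)"
proof -
  define n where "n = length vs"
  have len: "length ws = n"
    using vs ws unfolding enumerates_def n_def by (metis distinct_card)
  have dv: "distinct vs" and dw: "distinct ws" and sv: "set vs = set ws"
    using vs ws by (auto simp: enumerates_def)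
  have vsin: "vs ! i \<in> set ws" and wsin: "ws ! i \<in> set vs" if "i < n" for i
    using that sv len n_def by (metis nth_mem)+
  define P Q :: "real mat" where
    "P = mat n n (\<lambda>(i, j). if vs ! i = ws ! j then 1 else 0)" and
    "Q = mat n n (\<lambda>(i, j). if ws ! i = vs ! j then 1 else 0)"
  have carr: "P \<in> carrier_mat n n" "Q \<in> carrier_mat n n"
    "isi_matrix G vs \<in> carrier_mat n n" "isi_matrix G ws \<in> carrier_mat n n"
    by (auto simp: P_def Q_def isi_matrix_def n_def len[unfolded n_def])
  have if_mult: "(if b then 1 else 0) * c = (if b then c else 0)"
    "c * (if b then 1 else 0) = (if b then c else 0)" for b and c :: real by auto
  have PQ: "P * Q = 1\<^sub>m n"
  proof (rule eq_matI)
    fix i j assume "i < dim_row (1\<^sub>m n :: real mat)" "j < dim_col (1\<^sub>m n :: real mat)"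
    then have ij: "i < n" "j < n" by auto
    have "(P * Q) $$ (i, j) = (\<Sum>k<n. if vs ! i = ws ! k then if vs ! j = ws ! k then 1 else 0 else 0)"
      using ij by (auto simp: P_def Q_def scalar_prod_def atLeast0LessThan if_mult intro!: sum.cong)
    also have "\<dots> = (if vs ! j = vs ! i then 1 else 0)"
      using sum_nth_delta[OF dw vsin[OF ij(1)] len, of "\<lambda>y. if vs ! j = y then 1 else 0"] .
    also have "\<dots> = 1\<^sub>m n $$ (i, j)"
      using ij dv by (auto simp: n_def nth_eq_iff_index_eq)
    finally show "(P * Q) $$ (i, j) = 1\<^sub>m n $$ (i, j)" .
  qed (use carr in auto)
  define h where "h x y = (if (x, y) \<in> parcs G
     then real (gdegree G x) * real (gdegree G y) / (real (gdegree G x) + real (gdegree G y))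
     else 0)" for x y
  have isi: "isi_matrix G vs = mat n n (\<lambda>(i, j). h (vs ! i) (vs ! j))"
    "isi_matrix G ws = mat n n (\<lambda>(i, j). h (ws ! i) (ws ! j))"
    unfolding isi_matrix_def h_def len n_def[symmetric] by simp_all
  have AP: "isi_matrix G vs * P = P * isi_matrix G ws"
  proof (rule eq_matI)
    fix i j assume "i < dim_row (P * isi_matrix G ws)" "j < dim_col (P * isi_matrix G ws)"
    then have ij: "i < n" "j < n" using carr by auto
    have "(isi_matrix G vs * P) $$ (i, j) = (\<Sum>k<n. if ws ! j = vs ! k then h (vs ! i) (vs ! k) else 0)"
      unfolding isi using ij
      by (auto simp: P_def scalar_prod_def atLeast0LessThan if_mult intro!: sum.cong)
    also have "\<dots> = h (vs ! i) (ws ! j)"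
      using sum_nth_delta[OF dv wsin[OF ij(2)] n_def[symmetric], of "h (vs ! i)"] .
    also have "\<dots> = (\<Sum>k<n. if vs ! i = ws ! k then h (ws ! k) (ws ! j) else 0)"
      using sum_nth_delta[OF dw vsin[OF ij(1)] len, of "\<lambda>y. h y (ws ! j)"] by (rule sym)
    also have "\<dots> = (P * isi_matrix G ws) $$ (i, j)"
      unfolding isi using ij
      by (auto simp: P_def scalar_prod_def atLeast0LessThan if_mult intro!: sum.cong)
    finally show "(isi_matrix G vs * P) $$ (i, j) = (P * isi_matrix G ws) $$ (i, j)" .
  qed (use carr in auto)
  have QP: "Q * P = 1\<^sub>m n" using mat_mult_left_right_inverse[OF carr(1,2) PQ] .
  have "P * isi_matrix G ws * Q = isi_matrix G vs * (P * Q)"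
    using carr by (simp add: AP[symmetric] assoc_mult_mat)
  also have "\<dots> = isi_matrix G vs" using PQ carr by simp
  finally have "isi_matrix G vs = P * isi_matrix G ws * Q" by simp
  then show ?thesis
    unfolding similar_mat_def similar_mat_wit_def
    using carr PQ QP by (intro exI[of _ P] exI[of _ Q]) (auto simp: Let_def)
qed

lemma isi_energy_enumeration:
  assumes "enumerates vs (pverts G)"
  shows "isi_energy G = eigenvalue_abs_sum (isi_matrix G vs)"
proof -
  define ws where "ws = (SOME ws. enumerates ws (pverts G))"
  have ws: "enumerates ws (pverts G)" unfolding ws_def using assms by (rule someI)
  have carr: "isi_matrix G xs \<in> carrier_mat (length xs) (length xs)" for xs
    by (simp add: isi_matrix_def)
  have cp: "char_poly (isi_matrix G ws) = char_poly (isi_matrix G vs)"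
    using char_poly_similar[OF isi_matrix_similar[OF ws assms]] .
  then show ?thesis
    unfolding isi_energy_def ws_def[symmetric] eigenvalue_abs_sum_def
      eigenvalue_root_char_poly[OF carr] by simp
qed

end

theory Submission
  imports Defs
begin

text \<open>
  List the vertices as centre, \<open>u\<close>, \<open>v\<close>, remaining leaves. The two ISI matrices then have the same
  shape: the centre is joined to \<open>u\<close> and \<open>v\<close> with weight \<open>b\<close> and to the other leaves with weight
  \<open>a = (n - 1) / n\<close>, and \<open>u\<close>, \<open>v\<close> are joined with weight \<open>e\<close>. The star has \<open>b = a\<close> and \<open>e = 0\<close>;
  after adding the edge, \<open>b = 2 (n - 1) / (n + 1)\<close> and \<open>e = 1\<close>.

  Put \<open>s = 2 b\<^sup>2\<close> and \<open>t = (n - 3) a\<^sup>2\<close>. The characteristic polynomial of such a matrix is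
  \<open>x ^ (n - 4) (x + e) (x ^ 3 - e x\<^sup>2 - (s + t) x + e t)\<close>: the vectors supported on the remaining
  leaves with coordinate sum zero belong to the eigenvalue 0, the difference of the basis vectors of
  \<open>u\<close> and \<open>v\<close> belongs to \<open>- e\<close>, and the cubic comes from the vectors constant on \<open>{u, v}\<close> and
  on the remaining leaves. The cubic has one nonpositive root \<open>- \<alpha>\<close> and two nonnegative ones
  (\<open>kite_cubic_roots\<close>). Since the trace vanishes, the energy is twice the sum of the absolute
  values of the nonpositive eigenvalues, that is \<open>2 (e + \<alpha>)\<close> (\<open>eigenvalue_abs_sum_kite_mat\<close>).

  Let \<open>\<alpha>\<close> belong to the star and \<open>\<alpha>'\<close> to the graph with the added edge. It remains to show
  \<open>\<alpha> < 1 + \<alpha>'\<close>. The cubic of the star gives \<open>\<alpha>\<^sup>2 \<le> (n - 1) a\<^sup>2\<close>, and \<open>(n - 1) a\<^sup>2 \<le> s + t\<close> because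
  \<open>a \<le> b\<close>. The other cubic reads \<open>\<alpha>'\<^sup>2 (\<alpha>' + 1) = (s + t) \<alpha>' + t\<close>. If \<open>\<alpha>' + 1 \<le> \<alpha>\<close>, the left
  side is at most \<open>\<alpha>'\<^sup>2 \<alpha> \<le> \<alpha>\<^sup>2 \<alpha>'\<close>, while the right side exceeds \<open>\<alpha>\<^sup>2 \<alpha>'\<close> as \<open>t > 0\<close>
  (\<open>eigenvalue_abs_sum_kite_mat_less\<close>).
\<close>

section \<open>Energy from a factorized characteristic polynomial\<close>

text \<open>
  The list \<open>xs\<close> repeats every root as often as its multiplicity, so summing over the list does the
  weighting that the energy prescribes. This reduces energies to factorizations.
\<close>
lemma eigenvalue_abs_sum_linear_factors:
  assumes A: "A \<in> carrier_mat n n"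
    and cp: "char_poly A = (\<Prod>x\<leftarrow>xs. [:- x, 1:])"
  shows "eigenvalue_abs_sum A = (\<Sum>x\<leftarrow>xs. \<bar>x\<bar>)"
proof -
  have nz: "(\<Prod>x\<leftarrow>ys. [:- x, 1:]) \<noteq> (0 :: real poly)" for ys
    by (auto simp: prod_list_zero_iff)
  have ord: "Polynomial.order k [:- x, 1:] = (if k = x then 1 else 0)" for k x :: real
    using order_power_n_n[of x 1] by (auto intro: order_0I)
  \<comment> \<open>For the induction the range of summation must not shrink with the list, hence a superset \<open>T\<close>.\<close>
  have sum: "(\<Sum>k\<in>T. real (Polynomial.order k (\<Prod>x\<leftarrow>ys. [:- x, 1:])) * \<bar>k\<bar>) = (\<Sum>x\<leftarrow>ys. \<bar>x\<bar>)"
    if "finite T" "set ys \<subseteq> T" for T and ys :: "real list"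
    using that(2)
  proof (induction ys)
    case Nil
    then show ?case by simp
  next
    case (Cons y ys)
    have "Polynomial.order k (\<Prod>x\<leftarrow>y # ys. [:- x, 1:]) =
        (if k = y then 1 else 0) + Polynomial.order k (\<Prod>x\<leftarrow>ys. [:- x, 1:])" for k
      using order_mult[of "[:- y, 1:]" "\<Prod>x\<leftarrow>ys. [:- x, 1:]" k] nz[of "y # ys"] ord[of k y]
      by simp
    then have "(\<Sum>k\<in>T. real (Polynomial.order k (\<Prod>x\<leftarrow>y # ys. [:- x, 1:])) * \<bar>k\<bar>) =
        (\<Sum>k\<in>T. (if k = y then \<bar>k\<bar> else 0) +
          real (Polynomial.order k (\<Prod>x\<leftarrow>ys. [:- x, 1:])) * \<bar>k\<bar>)"
      by (intro sum.cong) (auto simp: algebra_simps)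
    also have "\<dots> = \<bar>y\<bar> + (\<Sum>x\<leftarrow>ys. \<bar>x\<bar>)"
      using Cons that(1) by (simp add: sum.distrib)
    finally show ?case by simp
  qed
  have "{k. eigenvalue A k} = set xs"
    unfolding eigenvalue_root_char_poly[OF A] cp
    by (auto simp: poly_prod_list prod_list_zero_iff)
  then show ?thesis
    unfolding eigenvalue_abs_sum_def cp using sum[of "set xs" xs] by simp
qed

section \<open>Characteristic polynomial of the common matrix\<close>

text \<open>
  Row 0 is the centre, rows 1 and 2 are the distinguished leaves. Keeping \<open>a\<close>, \<open>b\<close> and \<open>e\<close> free
  lets one computation serve the star and the star with an added edge.
\<close>
definition kite_mat :: "nat \<Rightarrow> real \<Rightarrow> real \<Rightarrow> real \<Rightarrow> real mat" where
  "kite_mat n a b e = mat n n (\<lambda>(i, j).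
     if {i, j} = {1, 2} then e
     else if i = 0 \<and> j \<noteq> 0 then if j \<le> 2 then b else a
     else if j = 0 \<and> i \<noteq> 0 then if i \<le> 2 then b else a
     else 0)"

lemma kite_mat_carrier: "kite_mat n a b e \<in> carrier_mat n n"
  by (simp add: kite_mat_def)

lemma sum_first_three:
  fixes n :: nat and f :: "nat \<Rightarrow> real"
  assumes "n \<ge> 3"
  shows "(\<Sum>l = 0..<n. f l) = f 0 + f 1 + f 2 + (\<Sum>l = 3..<n. f l)"
proof -
  have "{0..<n} = {0, 1, 2} \<union> {3..<n}" using assms by auto
  then show ?thesis by (simp add: sum.union_disjoint)
qed

text \<open>
  Eliminate the centre: with \<open>y = b / (k - e)\<close> and \<open>z = a / k\<close>, the matrix \<open>N = k I - A\<close> maps the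
  vector \<open>(1, y, y, z, ..., z)\<close> to \<open>k - 2 b y - (n - 3) a z\<close> times the first basis vector, and maps
  \<open>(0, 1, e / k, 0, ..., 0)\<close> to a vector supported on the first two coordinates. Taking these as the
  first two columns of a unit lower triangular matrix \<open>M\<close> makes \<open>N M\<close> upper triangular, and its
  diagonal gives the determinant. The divisions restrict \<open>k\<close>; infinitely many \<open>k\<close> remain, which
  determine the polynomial.
\<close>
lemma poly_char_poly_kite_mat:
  assumes n: "n \<ge> 3" and k: "k > e" "e \<ge> 0"
  shows "poly (char_poly (kite_mat n a b e)) k =
    (k - 2 * b\<^sup>2 / (k - e) - real (n - 3) * a\<^sup>2 / k) * (k\<^sup>2 - e\<^sup>2) * k ^ (n - 3)"
proof -
  define N where "N = - char_matrix (kite_mat n a b e) k"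
  define M where "M = mat n n (\<lambda>(i, j).
     if i = j then 1
     else if j = 0 then if i \<le> 2 then b / (k - e) else a / k
     else if i = 2 \<and> j = 1 then e / k else 0)"
  define U where "U = mat n n (\<lambda>(i, j).
     if i = j then if i = 0 then k - 2 * b\<^sup>2 / (k - e) - real (n - 3) * a\<^sup>2 / k
       else if i = 1 then k - e\<^sup>2 / k else k
     else if i = 0 then if j = 1 then - b - b * e / k else if j = 2 then - b else - a
     else if i = 1 \<and> j = 2 then - e else 0)"
  have carr: "N \<in> carrier_mat n n" "M \<in> carrier_mat n n" "U \<in> carrier_mat n n"
    by (auto simp: N_def M_def U_def char_matrix_def kite_mat_def)
  have N: "N $$ (i, j) = (if i = j then k else - kite_mat n a b e $$ (i, j))"
    if "i < n" "j < n" for i j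
    using that by (auto simp: N_def char_matrix_def kite_mat_def doubleton_eq_iff)
  have k0: "k \<noteq> 0" "k - e \<noteq> 0" using k by auto
  have "N * M = U"
  proof (rule eq_matI)
    fix i j assume "i < dim_row U" "j < dim_col U"
    then have ij: "i < n" "j < n" using carr by auto
    have "(N * M) $$ (i, j) = (\<Sum>l = 0..<n. N $$ (i, l) * M $$ (l, j))"
      using ij carr by (simp add: scalar_prod_def)
    also have "\<dots> = N $$ (i, 0) * M $$ (0, j) + N $$ (i, 1) * M $$ (1, j) + N $$ (i, 2) * M $$ (2, j)
        + (\<Sum>l = 3..<n. N $$ (i, l) * M $$ (l, j))"
      using n by (rule sum_first_three)
    also have "(\<Sum>l = 3..<n. N $$ (i, l) * M $$ (l, j)) =
        (if i = 0 then if j = 0 then - (real (n - 3) * a\<^sup>2 / k) else if j \<ge> 3 then - a else 0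
         else if i \<ge> 3 then if j = 0 then a else if i = j then k else 0 else 0)"
      (is "_ = ?rest")
    proof -
      have "(\<Sum>l = 3..<n. N $$ (i, l) * M $$ (l, j)) =
        (\<Sum>l = 3..<n. if i = 0 then if j = 0 then - a\<^sup>2 / k else if l = j then - a else 0
           else if l = i then if j = 0 then a else if i = j then k else 0 else 0)"
        using ij k0
        by (intro sum.cong refl) (auto simp: N M_def kite_mat_def doubleton_eq_iff power2_eq_square)
      also have "\<dots> = ?rest" using n ij by simp
      finally show ?thesis .
    qed
    also have "N $$ (i, 0) * M $$ (0, j) + N $$ (i, 1) * M $$ (1, j) + N $$ (i, 2) * M $$ (2, j)
      + ?rest = U $$ (i, j)"
    proof -
      have Ni: "N $$ (i, 0) = (if i = 0 then k else if i \<le> 2 then - b else - a)"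
        "N $$ (i, 1) = (if i = 0 then - b else if i = 1 then k else if i = 2 then - e else 0)"
        "N $$ (i, 2) = (if i = 0 then - b else if i = 1 then - e else if i = 2 then k else 0)"
        using n ij(1) N[of i 0] N[of i 1] N[of i 2] by (auto simp: kite_mat_def doubleton_eq_iff)
      have Mj: "M $$ (0, j) = (if j = 0 then 1 else 0)"
        "M $$ (1, j) = (if j = 0 then b / (k - e) else if j = 1 then 1 else 0)"
        "M $$ (2, j) = (if j = 0 then b / (k - e) else if j = 1 then e / k else if j = 2 then 1 else 0)"
        using n ij(2) by (auto simp: M_def)
      have U: "U $$ (i, j) = (if i = j then if i = 0 then k - 2 * b\<^sup>2 / (k - e) - real (n - 3) * a\<^sup>2 / k
         else if i = 1 then k - e\<^sup>2 / k else k
       else if i = 0 then if j = 1 then - b - b * e / k else if j = 2 then - b else - a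
       else if i = 1 \<and> j = 2 then - e else 0)"
        using ij by (simp add: U_def)
      define y where "y = b / (k - e)"
      have y: "k * y = b + e * y" "b\<^sup>2 / (k - e) = b * y"
        using k0 by (simp_all add: y_def field_simps power2_eq_square)
      have row: "i = 0 \<or> i = 1 \<or> i = 2 \<or> i \<ge> 3" by linarith
      have col: "j = 0 \<or> j = 1 \<or> j = 2 \<or> j \<ge> 3" by linarith
      show ?thesis
        unfolding Ni Mj U y_def[symmetric] times_divide_eq_right[symmetric] y(2)
        using row col k0(1) y(1)
        by (elim disjE) (simp_all add: power2_eq_square)
    qed
    finally show "(N * M) $$ (i, j) = U $$ (i, j)" .
  qed (use carr in auto)
  then have "det N * det M = det U"
    using det_mult[OF carr(1,2)] by simp
  moreover have "det M = 1"
  proof -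
    have "det M = prod_list (diag_mat M)"
      by (rule det_lower_triangular[OF _ carr(2)]) (auto simp: M_def)
    also have "\<dots> = (\<Prod>i = 0..<n. M $$ (i, i))"
      using carr by (simp add: prod_list_diag_prod)
    also have "\<dots> = 1"
      by (auto simp: M_def intro!: prod.neutral)
    finally show ?thesis .
  qed
  moreover have "det U = (k - 2 * b\<^sup>2 / (k - e) - real (n - 3) * a\<^sup>2 / k) * (k\<^sup>2 - e\<^sup>2) * k ^ (n - 3)"
  proof -
    have "det U = (\<Prod>i = 0..<n. U $$ (i, i))"
      using det_upper_triangular[OF _ carr(3)] carr
      by (auto simp: prod_list_diag_prod upper_triangular_def U_def)
    also have "{0..<n} = {0, 1, 2} \<union> {3..<n}" using n by auto
    also have "(\<Prod>i\<in>\<dots>. U $$ (i, i)) = U $$ (0, 0) * (U $$ (1, 1) * U $$ (2, 2)) * (\<Prod>i = 3..<n. U $$ (i, i))"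
      by (simp add: prod.union_disjoint)
    also have "(\<Prod>i = 3..<n. U $$ (i, i)) = (\<Prod>i = 3..<n. k)"
      by (intro prod.cong) (auto simp: U_def)
    also have "\<dots> = k ^ (n - 3)" by simp
    also have "U $$ (1, 1) * U $$ (2, 2) = k\<^sup>2 - e\<^sup>2"
      using n k0 by (simp add: U_def field_simps power2_eq_square)
    also have "U $$ (0, 0) = k - 2 * b\<^sup>2 / (k - e) - real (n - 3) * a\<^sup>2 / k"
      using n by (simp add: U_def)
    finally show ?thesis .
  qed
  ultimately show ?thesis
    unfolding char_poly_matrix[OF kite_mat_carrier] N_def by simp
qed

section \<open>Eigenvalues and energy\<close>

text \<open>
  The cubic is \<open>e t \<ge> 0\<close> at 0 and \<open>- s e \<le> 0\<close> at \<open>e\<close>, so it has a root \<open>\<beta>\<close> in \<open>[0, e]\<close>. Dividing by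
  \<open>x - \<beta>\<close> leaves \<open>x\<^sup>2 - (e - \<beta>) x - q\<close> with \<open>q = s + t + \<beta> (e - \<beta>) \<ge> 0\<close>, whose two roots are real
  with nonpositive product.
\<close>
lemma kite_cubic_roots:
  fixes e s t :: real
  assumes "e \<ge> 0" "s \<ge> 0" "t \<ge> 0"
  obtains \<alpha> \<beta> \<gamma> where "\<alpha> \<ge> 0" "\<beta> \<ge> 0" "\<gamma> \<ge> 0"
    "\<And>x. x ^ 3 - e * x\<^sup>2 - (s + t) * x + e * t = (x + \<alpha>) * (x - \<beta>) * (x - \<gamma>)"
proof -
  define p where "p x = x ^ 3 - e * x\<^sup>2 - (s + t) * x + e * t" for x
  have "p e \<le> 0" "p 0 \<ge> 0"
    using assms by (simp_all add: p_def algebra_simps power2_eq_square power3_eq_cube)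
  moreover have "\<forall>x. 0 \<le> x \<and> x \<le> e \<longrightarrow> isCont p x"
    by (auto simp: p_def[abs_def] intro!: continuous_intros)
  ultimately obtain \<beta> where \<beta>: "0 \<le> \<beta>" "\<beta> \<le> e" "p \<beta> = 0"
    using IVT2[of p e 0 0] assms by auto
  define q where "q = s + t + \<beta> * (e - \<beta>)"
  define d where "d = sqrt ((e - \<beta>)\<^sup>2 + 4 * q)"
  have q: "q \<ge> 0" using assms \<beta> by (simp add: q_def)
  have d: "d\<^sup>2 = (e - \<beta>)\<^sup>2 + 4 * q" "d \<ge> e - \<beta>"
    using q by (auto simp: d_def intro!: real_le_rsqrt)
  show ?thesis
  proof
    show "(d - (e - \<beta>)) / 2 \<ge> 0" "\<beta> \<ge> 0" "(d + (e - \<beta>)) / 2 \<ge> 0"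
      using d \<beta> by auto
    fix x
    have "(x + (d - (e - \<beta>)) / 2) * (x - (d + (e - \<beta>)) / 2) =
        x\<^sup>2 - (e - \<beta>) * x - (d\<^sup>2 - (e - \<beta>)\<^sup>2) / 4"
      by (simp add: field_simps power2_eq_square)
    also have "\<dots> = x\<^sup>2 - (e - \<beta>) * x - q" using d by simp
    finally have "(x + (d - (e - \<beta>)) / 2) * (x - \<beta>) * (x - (d + (e - \<beta>)) / 2) =
        (x\<^sup>2 - (e - \<beta>) * x - q) * (x - \<beta>)" by (simp add: mult_ac)
    also have "\<dots> = p x - p \<beta>"
      by (simp add: p_def q_def algebra_simps power2_eq_square power3_eq_cube)
    finally show "x ^ 3 - e * x\<^sup>2 - (s + t) * x + e * t =
        (x + (d - (e - \<beta>)) / 2) * (x - \<beta>) * (x - (d + (e - \<beta>)) / 2)"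
      using \<beta> by (simp add: p_def)
  qed
qed

text \<open>
  The eigenvalues other than 0 are \<open>- e\<close>, \<open>- \<alpha>\<close>, \<open>\<beta>\<close> and \<open>\<gamma>\<close>. Comparing the coefficients of \<open>x\<^sup>2\<close> gives
  \<open>\<beta> + \<gamma> = e + \<alpha>\<close>, so the energy depends on the negative root alone; the last equation says
  that \<open>- \<alpha>\<close> is a root of the cubic.
\<close>
lemma eigenvalue_abs_sum_kite_mat:
  assumes n: "n \<ge> 4" and e: "e \<ge> 0"
  obtains \<alpha> where "\<alpha> \<ge> 0" "eigenvalue_abs_sum (kite_mat n a b e) = 2 * (e + \<alpha>)"
    "\<alpha>\<^sup>2 * (\<alpha> + e) = (2 * b\<^sup>2 + real (n - 3) * a\<^sup>2) * \<alpha> + e * (real (n - 3) * a\<^sup>2)"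
proof -
  define s t where "s = 2 * b\<^sup>2" and "t = real (n - 3) * a\<^sup>2"
  have st: "s \<ge> 0" "t \<ge> 0" using n by (auto simp: s_def t_def)
  obtain \<alpha> \<beta> \<gamma> where nonneg: "\<alpha> \<ge> 0" "\<beta> \<ge> 0" "\<gamma> \<ge> 0" and
    fac: "\<And>x. x ^ 3 - e * x\<^sup>2 - (s + t) * x + e * t = (x + \<alpha>) * (x - \<beta>) * (x - \<gamma>)"
    by (rule kite_cubic_roots[OF e st]) blast
  define xs where "xs = replicate (n - 4) 0 @ [- e, - \<alpha>, \<beta>, \<gamma>]"
  have agree: "poly (char_poly (kite_mat n a b e)) k = poly (\<Prod>x\<leftarrow>xs. [:- x, 1:]) k"
    if "k > e" for k
  proof -
    have k0: "k \<noteq> 0" "k - e \<noteq> 0" using that e by auto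
    have "k ^ (n - 3) = k * k ^ (n - 4)"
      using n by (simp flip: power_Suc add: Suc_diff_le[symmetric] numeral_eq_Suc)
    then have "poly (char_poly (kite_mat n a b e)) k =
       (k - s / (k - e) - t / k) * (k - e) * k * (k + e) * k ^ (n - 4)"
      using poly_char_poly_kite_mat[of n e k a b] n e that
      by (simp add: s_def t_def power2_eq_square algebra_simps)
    also have "(k - s / (k - e) - t / k) * (k - e) * k = k ^ 3 - e * k\<^sup>2 - (s + t) * k + e * t"
      using k0 by (simp add: field_simps power2_eq_square power3_eq_cube)
    also note fac
    also have "(k + \<alpha>) * (k - \<beta>) * (k - \<gamma>) * (k + e) * k ^ (n - 4) = (\<Prod>x\<leftarrow>xs. k - x)"
      by (simp add: xs_def prod_list_replicate mult_ac)
    also have "\<dots> = poly (\<Prod>x\<leftarrow>xs. [:- x, 1:]) k"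
      by (simp add: poly_prod_list o_def)
    finally show ?thesis .
  qed
  have "char_poly (kite_mat n a b e) - (\<Prod>x\<leftarrow>xs. [:- x, 1:]) = 0"
  proof (rule ccontr)
    assume "char_poly (kite_mat n a b e) - (\<Prod>x\<leftarrow>xs. [:- x, 1:]) \<noteq> 0"
    from poly_roots_finite[OF this] have "finite {e<..}"
      by (rule finite_subset[rotated]) (auto simp: agree)
    then show False using infinite_Ioi by blast
  qed
  then have "char_poly (kite_mat n a b e) = (\<Prod>x\<leftarrow>xs. [:- x, 1:])" by simp
  from eigenvalue_abs_sum_linear_factors[OF kite_mat_carrier this]
  have energy: "eigenvalue_abs_sum (kite_mat n a b e) = e + \<alpha> + \<beta> + \<gamma>"
    using nonneg e by (simp add: xs_def sum_list_replicate)
  \<comment> \<open>The second difference of the cubic at 0 isolates the coefficient of \<open>x\<^sup>2\<close>.\<close>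
  have "e = \<beta> + \<gamma> - \<alpha>"
    using fac[of 1] fac[of "-1"] fac[of 0] by (simp add: algebra_simps)
  then have "eigenvalue_abs_sum (kite_mat n a b e) = 2 * (e + \<alpha>)"
    using energy by simp
  moreover have "\<alpha>\<^sup>2 * (\<alpha> + e) = (s + t) * \<alpha> + e * t"
    using fac[of "- \<alpha>"] by (simp add: algebra_simps power2_eq_square power3_eq_cube)
  ultimately show ?thesis using nonneg that by (simp add: s_def t_def)
qed

text \<open>
  With \<open>\<alpha>\<close> and \<open>\<alpha>'\<close> as above, the claim is \<open>\<alpha> < 1 + \<alpha>'\<close>. The new edge itself contributes the 1; raising
  the weight from \<open>a\<close> to \<open>b\<close> only helps, and strictness comes from the \<open>n - 3\<close> leaves that keep
  weight \<open>a\<close>, through the term \<open>(n - 3) a\<^sup>2 > 0\<close>.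
\<close>
lemma eigenvalue_abs_sum_kite_mat_less:
  assumes n: "n \<ge> 4" and ab: "0 < a" "a \<le> b"
  shows "eigenvalue_abs_sum (kite_mat n a a 0) < eigenvalue_abs_sum (kite_mat n a b 1)"
proof -
  obtain \<alpha> where \<alpha>: "\<alpha> \<ge> 0" "eigenvalue_abs_sum (kite_mat n a a 0) = 2 * (0 + \<alpha>)"
    "\<alpha>\<^sup>2 * (\<alpha> + 0) = (2 * a\<^sup>2 + real (n - 3) * a\<^sup>2) * \<alpha> + 0 * (real (n - 3) * a\<^sup>2)"
    by (rule eigenvalue_abs_sum_kite_mat[OF n order_refl])
  obtain \<alpha>' where \<alpha>': "\<alpha>' \<ge> 0" "eigenvalue_abs_sum (kite_mat n a b 1) = 2 * (1 + \<alpha>')"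
    "\<alpha>'\<^sup>2 * (\<alpha>' + 1) = (2 * b\<^sup>2 + real (n - 3) * a\<^sup>2) * \<alpha>' + 1 * (real (n - 3) * a\<^sup>2)"
    by (rule eigenvalue_abs_sum_kite_mat[OF n zero_le_one])
  have "\<alpha> < \<alpha>' + 1"
  proof (rule ccontr)
    assume "\<not> \<alpha> < \<alpha>' + 1"
    then have le: "\<alpha>' + 1 \<le> \<alpha>" by simp
    \<comment> \<open>Here \<open>\<alpha> \<ge> 1\<close>, so \<open>\<alpha>\<close> cancels in the cubic equation of the star.\<close>
    have "\<alpha>\<^sup>2 = 2 * a\<^sup>2 + real (n - 3) * a\<^sup>2" using \<alpha> \<alpha>' le by simp
    also have "\<dots> \<le> 2 * b\<^sup>2 + real (n - 3) * a\<^sup>2" using ab by (simp add: power_mono)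
    finally have "\<alpha>\<^sup>2 * \<alpha>' \<le> (2 * b\<^sup>2 + real (n - 3) * a\<^sup>2) * \<alpha>'"
      using \<alpha>' by (intro mult_right_mono)
    also have "\<dots> < \<alpha>'\<^sup>2 * (\<alpha>' + 1)" using \<alpha>'(3) n ab by simp
    also have "\<dots> \<le> \<alpha>' * \<alpha> * \<alpha>"
      using le \<alpha>'(1) \<alpha>(1) unfolding power2_eq_square by (intro mult_mono) auto
    finally show False by (simp add: power2_eq_square mult_ac)
  qed
  then show ?thesis using \<alpha> \<alpha>' by simp
qed

section \<open>The ISI matrices of the two graphs\<close>

lemma gdegree_eq_card_neighbours: "gdegree G x = card {y. (x, y) \<in> parcs G}"
proof -
  have "{e \<in> parcs G. fst e = x} = Pair x ` {y. (x, y) \<in> parcs G}" by auto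
  then show ?thesis
    by (simp add: gdegree_def out_degree_def out_arcs_def card_image inj_on_def)
qed

text \<open>
  The flag \<open>E\<close> says whether the edge between \<open>u\<close> and \<open>v\<close> is present, and \<open>d\<close> is the resulting degree
  of its ends (1 or 2), so that one computation of entries covers both graphs.
\<close>
lemma isi_matrix_eq_kite_mat:
  assumes vs: "vs = c # u # v # ws" "distinct vs" and n: "length vs = n"
    and arcs: "\<And>x y. x \<in> set vs \<Longrightarrow> y \<in> set vs \<Longrightarrow>
      (x, y) \<in> parcs G \<longleftrightarrow> x \<noteq> y \<and> (x = c \<or> y = c \<or> E \<and> {x, y} = {u, v})"
    and deg: "gdegree G c = n - 1" "gdegree G u = d" "gdegree G v = d" "\<And>w. w \<in> set ws \<Longrightarrow> gdegree G w = 1"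
  shows "isi_matrix G vs = kite_mat n (real (n - 1) / n)
    (real (n - 1) * d / (real (n - 1) + d)) (if E then real d / 2 else 0)"
proof (rule eq_matI)
  fix i j assume "i < dim_row (kite_mat n (real (n - 1) / n)
    (real (n - 1) * d / (real (n - 1) + d)) (if E then real d / 2 else 0))"
    "j < dim_col (kite_mat n (real (n - 1) / n)
    (real (n - 1) * d / (real (n - 1) + d)) (if E then real d / 2 else 0))"
  then have ij: "i < n" "j < n" by (auto simp: kite_mat_def)
  have mem: "vs ! i \<in> set vs" "vs ! j \<in> set vs" using ij n by auto
  have eq: "vs ! i = vs ! j \<longleftrightarrow> i = j" using ij n vs(2) by (simp add: nth_eq_iff_index_eq)
  have heads: "vs ! 0 = c" "vs ! 1 = u" "vs ! 2 = v" "n \<ge> 3" using vs(1) n by auto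
  have pos: "vs ! l = c \<longleftrightarrow> l = 0" "vs ! l = u \<longleftrightarrow> l = 1" "vs ! l = v \<longleftrightarrow> l = 2" if "l < n" for l
    using that n heads(4) nth_eq_iff_index_eq[OF vs(2), of l 0] nth_eq_iff_index_eq[OF vs(2), of l 1]
      nth_eq_iff_index_eq[OF vs(2), of l 2] unfolding heads by simp_all
  have nr: "real (n - 1) + 1 = n" using heads(4) by simp
  have degs: "gdegree G (vs ! l) = (if l = 0 then n - 1 else if l \<le> 2 then d else 1)" if "l < n" for l
  proof (cases "l \<le> 2")
    case True
    then consider "l = 0" | "l = 1" | "l = 2" by linarith
    then show ?thesis using deg(1-3) heads(1-3) by cases simp_all
  next
    case False
    then have "vs ! l = ws ! (l - 3)" "l - 3 < length ws"
      using that n vs(1) by (auto simp: nth_Cons' numeral_eq_Suc)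
    then show ?thesis using False deg(4) by simp
  qed
  have "isi_matrix G vs $$ (i, j) = (if i \<noteq> j \<and> (i = 0 \<or> j = 0 \<or> E \<and> {i, j} = {1, 2}) then
     real (gdegree G (vs ! i)) * real (gdegree G (vs ! j)) /
          (real (gdegree G (vs ! i)) + real (gdegree G (vs ! j))) else 0)"
    using ij n arcs[OF mem] eq pos[OF ij(1)] pos[OF ij(2)]
    by (simp add: isi_matrix_def doubleton_eq_iff)
  also have "\<dots> = kite_mat n (real (n - 1) / n)
    (real (n - 1) * d / (real (n - 1) + d)) (if E then real d / 2 else 0) $$ (i, j)"
    unfolding degs[OF ij(1)] degs[OF ij(2)]
    using ij nr by (auto simp: kite_mat_def doubleton_eq_iff mult.commute add.commute)
  finally show "isi_matrix G vs $$ (i, j) = kite_mat n (real (n - 1) / n)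
    (real (n - 1) * d / (real (n - 1) + d)) (if E then real d / 2 else 0) $$ (i, j)" .
qed (use n in \<open>auto simp: isi_matrix_def kite_mat_def\<close>)

theorem theorem3p15:
  fixes S :: "'a pair_pre_digraph" and u v :: 'a and n :: nat
  assumes "n \<ge> 4"
    and "K\<^bsub>1,n - 1\<^esub> (with_proj S)"
    and "is_leaf S u" and "is_leaf S v" and "u \<noteq> v"
  shows "isi_energy (add_edge u v S) > isi_energy S \<and>
         isi_energy (del_edge u v (add_edge u v S)) < isi_energy (add_edge u v S)"
proof -
  obtain C V where fin: "finite (pverts S)" and CV: "pverts S = C \<union> V" "C \<inter> V = {}"
    "card C = 1" "card V = n - 1" "parcs S = C \<times> V \<union> V \<times> C"
    using assms(2) unfolding complete_bipartite_digraph_pair_def by blast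
  obtain c where C: "C = {c}" using CV(3) by (auto simp: card_1_singleton_iff)
  have cV: "c \<notin> V" and finV: "finite V" using CV C fin by auto
  have degc: "gdegree S c = n - 1"
  proof -
    have "{y. (c, y) \<in> parcs S} = V" using CV(5) C cV by auto
    then show ?thesis using CV(4) by (simp add: gdegree_eq_card_neighbours)
  qed
  have degV: "gdegree S x = 1" if "x \<in> V" for x
  proof -
    have "{y. (x, y) \<in> parcs S} = {c}" using CV(5) C cV that by auto
    then show ?thesis by (simp add: gdegree_eq_card_neighbours)
  qed
  \<comment> \<open>The centre has degree at least 3, so it is not one of the two leaves.\<close>
  have "u \<noteq> c" "v \<noteq> c" using assms(1,3,4) degc by (auto simp: is_leaf_def)
  then have uv: "u \<in> V" "v \<in> V" using assms(3,4) CV(1) C by (auto simp: is_leaf_def)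
  obtain ws where ws: "set ws = V - {u, v}" "distinct ws"
    using finite_distinct_list finV by (metis finite_Diff)
  define vs where "vs = c # u # v # ws"
  have dvs: "distinct vs" using ws uv cV assms(5) by (auto simp: vs_def)
  have svs: "set vs = insert c V" using ws uv by (auto simp: vs_def)
  have lvs: "length vs = n"
    using distinct_card[OF dvs] svs CV(4) finV cV assms(1) by simp
  let ?G = "add_edge u v S"
  have nb: "{y. (c, y) \<in> parcs ?G} = V" "{y. (u, y) \<in> parcs ?G} = {c, v}"
    "{y. (v, y) \<in> parcs ?G} = {c, u}" "w \<in> set ws \<Longrightarrow> {y. (w, y) \<in> parcs ?G} = {c}" for w
    using CV(5) C cV uv assms(5) ws by (auto simp: add_edge_def)
  have deg': "gdegree ?G c = n - 1" "gdegree ?G u = 2" "gdegree ?G v = 2"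
    and deg'_ws: "w \<in> set ws \<Longrightarrow> gdegree ?G w = 1" for w
    using nb(1-3) nb(4)[of w] CV(4) \<open>u \<noteq> c\<close> \<open>v \<noteq> c\<close>
    by (simp_all add: gdegree_eq_card_neighbours)
  define a b where "a = real (n - 1) / n" and "b = real (n - 1) * 2 / (real (n - 1) + 2)"
  have arcs: "(x, y) \<in> parcs S \<longleftrightarrow> x \<noteq> y \<and> (x = c \<or> y = c)"
    "(x, y) \<in> parcs ?G \<longleftrightarrow> x \<noteq> y \<and> (x = c \<or> y = c \<or> {x, y} = {u, v})"
    if "x \<in> set vs" "y \<in> set vs" for x y
    using that CV(5) C cV svs assms(5) by (auto simp: add_edge_def doubleton_eq_iff)
  have "isi_matrix S vs = kite_mat n a a 0"
    using isi_matrix_eq_kite_mat[OF vs_def dvs lvs, of S False 1] arcs(1) degc degV uv ws assms(1)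
    by (simp add: a_def of_nat_diff)
  then have star: "isi_energy S = eigenvalue_abs_sum (kite_mat n a a 0)"
    using isi_energy_enumeration[of vs S] dvs svs CV(1) C by (simp add: enumerates_def)
  have "isi_matrix ?G vs = kite_mat n a b 1"
    using isi_matrix_eq_kite_mat[OF vs_def dvs lvs, of ?G True 2] arcs(2) deg' deg'_ws
    by (simp add: a_def b_def)
  then have star_plus: "isi_energy ?G = eigenvalue_abs_sum (kite_mat n a b 1)"
    using isi_energy_enumeration[of vs ?G] dvs svs CV(1) C
    by (simp add: enumerates_def add_edge_def)
  have "0 < a" using assms(1) by (simp add: a_def)
  \<comment> \<open>Clearing denominators, this follows from \<open>(n - 1)\<^sup>2 \<ge> 0\<close>.\<close>
  moreover have "a \<le> b"
    using assms(1) zero_le_power2[of "real n - 1"]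
    by (simp add: a_def b_def field_simps power2_eq_square)
  ultimately have "isi_energy S < isi_energy ?G"
    using eigenvalue_abs_sum_kite_mat_less[OF assms(1)] star star_plus by simp
  moreover have "del_edge u v ?G = S"
  proof -
    have "(u, v) \<notin> parcs S" "(v, u) \<notin> parcs S" using CV(5) C \<open>u \<noteq> c\<close> \<open>v \<noteq> c\<close> by auto
    then have "parcs S \<union> {(u, v), (v, u)} - {(u, v), (v, u)} = parcs S" by blast
    then show ?thesis by (simp add: del_edge_def add_edge_def)
  qed
  ultimately show ?thesis by simp
qed

end
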